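(* Let $A\in\mathbb{R}^{n\times n}$, $B\in\mathbb{R}^{n\times m}$, $C\in\mathbb{R}^{k\times n}$, $D\in\mathbb{R}^{k\times m}$ define the linear time-invariant system $\dot x=Ax+Bu$, $y=Cx+Du$. Assume that there exist $K=K^{\mathsf T}\in\mathbb{R}^{n\times n}$ and $\gamma,\tau_1,\dots,\tau_k\in\mathbb{R}$ such that (a) $A^{\mathsf T}K+KA+2\gamma K\preceq 0$; (b) $B_{(:,j)}^{\mathsf T}KB_{(:,j)}\le 0$ for all $1\le j\le m$; (c) $\lambda_{n-1}(K)>0>\lambda_n(K)$; (d) $K+\tau_i C_{(i,:)}^{\mathsf T}C_{(i,:)}\succ 0$ for all $1\le i\le k$; (e) $CB$ and $D$ are entrywise nonnegative. Then $(A,B,C,D)$ is $\mathcal{K}_{K,c}$-positive with $c=C_{(1,:)}^{\mathsf T}$, and thus externally positive, and all entries of $Ce^{At}B$ are strictly positive for all $t\ge 0$.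
   Context: $B_{(:,j)}$ denotes the $j$-th column of $B$ and $C_{(i,:)}$ the $i$-th row of $C$. $\lambda_1(K)\ge\dots\ge\lambda_n(K)$ are the eigenvalues of the symmetric matrix $K$ in decreasing order (condition (c) says that $K$ has exactly $n-1$ positive and one negative eigenvalue). $\succ,\succeq,\preceq$ refer to the positive (semi)definite order. For symmetric $K\in\mathbb{R}^{n\times n}$ and $c\in\mathbb{R}^n$, $\mathcal{K}_{K,c}:=\{x\in\mathbb{R}^n: x^{\mathsf T}Kx\le 0,\ c^{\mathsf T}x\ge 0\}$. A convex cone is proper if it is closed, has nonempty interior and is pointed ($\mathcal{K}\cap-\mathcal{K}=\{0\}$). The dual cone is $\mathcal{K}^\ast=\{y: y^{\mathsf T}x\ge 0\ \forall x\in\mathcal{K}\}$. A set $\mathcal{K}\subset\mathbb{R}^n$ is exponentially $A$-invariant (also: $e^{At}$-invariant) if $e^{At}\mathcal{K}\subset\mathcal{K}$ for all $t\ge0$, and $(A,B)$-invariant if it is exponentially $A$-invariant and $B_{(:,j)}\in\mathcal{K}$ for all $j$. The system $(A,B,C,D)$ is externally positive if for $x(0)=0$ every entrywise nonnegative input $u:\mathbb{R}_{\ge0}\to\mathbb{R}^m$ yields an entrywise nonnegative output $y$. The system is called $\mathcal{K}$-positive if $\mathcal{K}$ is a proper convex $(A,B)$-invariant cone with $C_{(i,:)}^{\mathsf T}\in\mathcal{K}^\ast$ for all $1\le i\le k$ and $D$ is entrywise nonnegative.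
   Formalization: It is additionally assumed that no column of B is zero; otherwise a column of Ce^{At}B vanishes and strict positivity fails (e.g. A=0, B=0, D=0, K=diag(1,-1), C=(0 1), γ=0, τ_1=2 satisfies (a)-(e)). *)

theory Defs
  imports "HOL-Analysis.Analysis" "HOL-Computational_Algebra.Computational_Algebra"
begin

(* Matrix powers with respect to the matrix product: the library operation (^)
   on vectors of vectors, where it exists, is componentwise. *)
primrec mat_power :: "real^'n^'n \<Rightarrow> nat \<Rightarrow> real^'n^'n" where
  "mat_power A 0 = mat 1"
| "mat_power A (Suc k) = A ** mat_power A k"

definition mat_exp :: "real^'n^'n \<Rightarrow> real^'n^'n" where
  "mat_exp A = (\<Sum>k. (1 / fact k) *\<^sub>R mat_power A k)"

definition nonneg_vec :: "real^'n \<Rightarrow> bool" where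
  "nonneg_vec v \<longleftrightarrow> (\<forall>i. 0 \<le> v $ i)"

definition nonneg_mat :: "real^'m^'n \<Rightarrow> bool" where
  "nonneg_mat M \<longleftrightarrow> (\<forall>i j. 0 \<le> M $ i $ j)"

definition pos_semidef :: "real^'n^'n \<Rightarrow> bool" where
  "pos_semidef M \<longleftrightarrow> transpose M = M \<and> (\<forall>x. 0 \<le> x \<bullet> (M *v x))"

definition pos_def :: "real^'n^'n \<Rightarrow> bool" where
  "pos_def M \<longleftrightarrow> transpose M = M \<and> (\<forall>x. x \<noteq> 0 \<longrightarrow> 0 < x \<bullet> (M *v x))"

definition loewner_le :: "real^'n^'n \<Rightarrow> real^'n^'n \<Rightarrow> bool" (infix "\<preceq>\<^sub>L" 50) where
  "M \<preceq>\<^sub>L N \<longleftrightarrow> pos_semidef (N - M)"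

definition loewner_less :: "real^'n^'n \<Rightarrow> real^'n^'n \<Rightarrow> bool" (infix "\<prec>\<^sub>L" 50) where
  "M \<prec>\<^sub>L N \<longleftrightarrow> pos_def (N - M)"

definition outer :: "real^'n \<Rightarrow> real^'m \<Rightarrow> real^'m^'n" where
  "outer v w = (\<chi> i j. v $ i * w $ j)"

definition charpoly :: "real^'n^'n \<Rightarrow> real poly" where
  "charpoly M = det (mat [:0, 1:] - (\<chi> i j. [:M $ i $ j:]))"

(* The i-th largest real eigenvalue, counted with multiplicity, 1-based. For a
   symmetric matrix all n = CARD('n) eigenvalues are real, so that it is
   meaningful for 1 \<le> i \<le> n; for other i the value is junk. *)
definition eigval :: "real^'n^'n \<Rightarrow> nat \<Rightarrow> real" where
  "eigval M i = rev (sorted_list_of_multiset (proots (charpoly M))) ! (i - 1)"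

definition quad_cone :: "real^'n^'n \<Rightarrow> real^'n \<Rightarrow> (real^'n) set" where
  "quad_cone K c = {x. x \<bullet> (K *v x) \<le> 0 \<and> 0 \<le> c \<bullet> x}"

definition proper_convex_cone :: "(real^'n) set \<Rightarrow> bool" where
  "proper_convex_cone S \<longleftrightarrow>
     convex_cone S \<and> closed S \<and> interior S \<noteq> {} \<and> S \<inter> uminus ` S = {0}"

definition dual_cone :: "(real^'n) set \<Rightarrow> (real^'n) set" where
  "dual_cone S = {y. \<forall>x\<in>S. 0 \<le> y \<bullet> x}"

definition exp_invariant :: "real^'n^'n \<Rightarrow> (real^'n) set \<Rightarrow> bool" where
  "exp_invariant A S \<longleftrightarrow> (\<forall>t\<ge>0. (\<lambda>x. mat_exp (t *\<^sub>R A) *v x) ` S \<subseteq> S)"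

definition AB_invariant :: "real^'n^'n \<Rightarrow> real^'m^'n \<Rightarrow> (real^'n) set \<Rightarrow> bool" where
  "AB_invariant A B S \<longleftrightarrow> exp_invariant A S \<and> (\<forall>j. column j B \<in> S)"

(* x' = A x + B u on [0,\<infinity>) in integrated form, so that discontinuous inputs
   (e.g. piecewise continuous or locally integrable ones) are admitted. *)
definition lti_trajectory ::
  "real^'n^'n \<Rightarrow> real^'m^'n \<Rightarrow> (real \<Rightarrow> real^'m) \<Rightarrow> (real \<Rightarrow> real^'n) \<Rightarrow> bool" where
  "lti_trajectory A B u x \<longleftrightarrow>
     (\<forall>t\<ge>0. ((\<lambda>s. A *v x s + B *v u s) has_integral (x t - x 0)) {0..t})"

definition externally_positive ::
  "real^'n^'n \<Rightarrow> real^'m^'n \<Rightarrow> real^'n^'k \<Rightarrow> real^'m^'k \<Rightarrow> bool" where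
  "externally_positive A B C D \<longleftrightarrow>
     (\<forall>u x. lti_trajectory A B u x \<and> x 0 = 0 \<and> (\<forall>t\<ge>0. nonneg_vec (u t))
        \<longrightarrow> (\<forall>t\<ge>0. nonneg_vec (C *v x t + D *v u t)))"

definition cone_positive ::
  "(real^'n) set \<Rightarrow> real^'n^'n \<Rightarrow> real^'m^'n \<Rightarrow> real^'n^'k \<Rightarrow> real^'m^'k \<Rightarrow> bool" where
  "cone_positive S A B C D \<longleftrightarrow>
     proper_convex_cone S \<and> AB_invariant A B S \<and> (\<forall>i. row i C \<in> dual_cone S) \<and> nonneg_mat D"

end

theory Submission
  imports Defs
begin

text \<open>
  Write \<open>Q(x) = x\<^sup>T K x\<close>, \<open>q\<^sub>i\<close> for the \<open>i\<close>-th row of \<open>C\<close> and \<open>q\<^sub>1\<close> for the row with index \<open>i1\<close>.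
  The last eigenvalue of \<open>K\<close> is negative, so \<open>Q\<close> takes a negative value (\<open>eigval_is_eigenvalue\<close>), which
  gives \<open>quad_cone K q\<^sub>1\<close> an interior. On the hyperplane \<open>q\<^sub>i \<bullet> x = 0\<close> assumption \<open>d\<close> says that
  \<open>Q\<close> is positive definite, so the double cone \<open>{Q \<le> 0}\<close> meets that hyperplane only at the origin
  (\<open>pos_on_hyperplane\<close>); this fact carries the rest of the argument about the cone. If \<open>x, y\<close> lie in
  \<open>quad_cone K q\<^sub>1\<close>, then the combination
  \<open>(q\<^sub>1 \<bullet> y) x - (q\<^sub>1 \<bullet> x) y\<close> lies on the hyperplane, and \<open>Q \<ge> 0\<close> there is the reverse Cauchy-Schwarz
  inequality that makes the cone convex (\<open>quad_cone_add\<close>). A functional \<open>q\<^sub>i\<close> that vanishes nowhere on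
  the nonzero part of a convex pointed cone has constant sign there, and a column of \<open>B\<close> together with
  \<open>C B \<ge> 0\<close> shows that the sign is positive (\<open>quad_cone_functional_pos\<close>).

  By assumption \<open>a\<close>, \<open>e\<^bsup>2\<gamma>t\<^esup> Q(x(t))\<close> is nonincreasing along solutions of \<open>x' = A x\<close>
  (\<open>quadratic_form_decay\<close>), so \<open>{Q \<le> 0}\<close> is invariant; a solution could pass from one nappe to the other
  only through the origin, which a nonzero solution never reaches. Hence \<open>quad_cone K q\<^sub>1\<close> is invariant
  (\<open>quad_cone_exp_invariant\<close>), \<open>e\<^bsup>At\<^esup>\<close> maps the columns of \<open>B\<close> to nonzero vectors of it, and
  \<open>C e\<^bsup>At\<^esup> B\<close> is entrywise positive.

  External positivity needs only \<open>C e\<^bsup>At\<^esup> B \<ge> 0\<close>, but the input is not assumed measurable and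
  the state is given by an integral equation, so neither the variation of constants formula nor
  differentiation of the state is directly available. Both are avoided by working with the continuously
  differentiable \<open>X(t) = \<integral>\<^sub>0\<^sup>t x\<close> and its increments \<open>X(t + h) - X(t)\<close>, which solve
  linear equations whose inhomogeneity is an integral of \<open>B u\<close> (\<open>trajectory_functional_nonneg\<close>).
\<close>

(* The dollar sign is left to the components of vectors. *)
no_notation fps_nth (infixl "$" 75)

section \<open>Matrix products and symmetric matrices\<close>

lemma bounded_bilinear_matrix_vector_mult:
  "bounded_bilinear ((*v) :: real^'n^'m \<Rightarrow> real^'n \<Rightarrow> real^'m)"
proof -
  have "linear (\<lambda>M :: real^'n^'m. M *v x)" for x
    by (rule linearI) (simp_all add: matrix_vector_mult_add_rdistrib flip: scaleR_matrix_vector_assoc)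
  then show ?thesis
    by (simp add: bilinear_def flip: bilinear_conv_bounded_bilinear)
qed

lemma bounded_bilinear_matrix_matrix_mult:
  "bounded_bilinear ((**) :: real^'n^'m \<Rightarrow> real^'p^'n \<Rightarrow> real^'p^'m)"
proof -
  have "linear (\<lambda>M :: real^'n^'m. M ** N)" for N :: "real^'p^'n"
    by (rule linearI)
      (simp_all add: vec_eq_iff matrix_matrix_mult_def sum.distrib sum_distrib_left algebra_simps)
  moreover have "linear (\<lambda>N :: real^'p^'n. M ** N)" for M :: "real^'n^'m"
    by (rule linearI)
      (simp_all add: vec_eq_iff matrix_matrix_mult_def sum.distrib sum_distrib_left algebra_simps)
  ultimately show ?thesis
    by (simp add: bilinear_def flip: bilinear_conv_bounded_bilinear)
qed

lemma symmetric_dot: "transpose K = K \<Longrightarrow> x \<bullet> (K *v y) = (K *v x) \<bullet> y" for K :: "real^'n^'n"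
  by (metis dot_lmul_matrix transpose_matrix_vector)

lemma matrix_triple_entry: "(C ** M ** B) $ i $ j = row i C \<bullet> (M *v column j B)"
  for C :: "real^'n^'k" and M :: "real^'n^'n" and B :: "real^'m^'n"
proof -
  have "(C ** M ** B) $ i $ j = ((C ** M) *v column j B) $ i"
    by (simp add: matrix_matrix_mult_def matrix_vector_mult_def column_def)
  also have "\<dots> = (C *v (M *v column j B)) $ i"
    by (simp add: matrix_vector_mul_assoc)
  finally show ?thesis
    by (simp add: matrix_vector_mul_component row_def vec_nth_inverse)
qed

section \<open>The matrix exponential\<close>

lemma mat_power_scaleR: "mat_power (t *\<^sub>R A) k = t ^ k *\<^sub>R mat_power A k" for A :: "real^'n^'n"
  by (induction k) (simp_all add: matrix_scalar_ac mult.commute flip: scalar_matrix_assoc)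

lemma mat_power_Suc_right: "mat_power A (Suc k) = mat_power A k ** A"
proof (induction k)
  case (Suc k)
  have "mat_power A (Suc (Suc k)) = A ** (mat_power A k ** A)"
    using Suc by simp
  then show ?case by (simp add: matrix_mul_assoc)
qed simp

lemma summable_mat_exp: "summable (\<lambda>k. (1 / fact k) *\<^sub>R mat_power A k)" for A :: "real^'n^'n"
proof -
  obtain L where L: "\<And>M :: real^'n^'n. norm (A ** M) \<le> norm M * L" and "L > 0"
    using bounded_linear.pos_bounded[OF bounded_bilinear.bounded_linear_right[OF bounded_bilinear_matrix_matrix_mult]]
    by metis
  have bound: "norm (mat_power A k) \<le> norm (mat 1 :: real^'n^'n) * L ^ k" for k
  proof (induction k)
    case (Suc k)
    have "norm (mat_power A (Suc k)) \<le> norm (mat_power A k) * L"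
      using L by simp
    also have "\<dots> \<le> norm (mat 1 :: real^'n^'n) * L ^ k * L"
      using Suc \<open>L > 0\<close> by (intro mult_right_mono) auto
    finally show ?case by (simp add: mult_ac)
  qed simp
  have "summable (\<lambda>k. norm (mat 1 :: real^'n^'n) * (inverse (fact k) * L ^ k))"
    by (intro summable_mult summable_exp)
  then show ?thesis
  proof (rule summable_comparison_test'[where N = 0])
    fix k :: nat
    show "norm ((1 / fact k) *\<^sub>R mat_power A k) \<le> norm (mat 1 :: real^'n^'n) * (inverse (fact k) * L ^ k)"
      using bound[of k] by (simp add: field_simps)
  qed
qed

lemma mat_exp_sums: "(\<lambda>k. (1 / fact k) *\<^sub>R mat_power A k) sums mat_exp A" for A :: "real^'n^'n"
  unfolding mat_exp_def by (rule summable_sums[OF summable_mat_exp])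

lemma mat_exp_entry_sums: "(\<lambda>k. mat_power A k $ i $ j / fact k * t ^ k) sums (mat_exp (t *\<^sub>R A) $ i $ j)"
  for A :: "real^'n^'n"
proof -
  have "bounded_linear (\<lambda>M :: real^'n^'n. M $ i $ j)"
    by (intro bounded_linear_intros bounded_linear_compose[OF bounded_linear_vec_nth]) 
  from bounded_linear.sums[OF this mat_exp_sums[of "t *\<^sub>R A"]]
  show ?thesis by (simp add: mat_power_scaleR mult_ac)
qed

lemma mat_exp_commute: "A ** mat_exp (t *\<^sub>R A) = mat_exp (t *\<^sub>R A) ** A" for A :: "real^'n^'n"
proof (rule sums_unique2)
  note R = bounded_bilinear.bounded_linear_right[OF bounded_bilinear_matrix_matrix_mult]
  note L = bounded_bilinear.bounded_linear_left[OF bounded_bilinear_matrix_matrix_mult]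
  show "(\<lambda>k. A ** ((1 / fact k) *\<^sub>R mat_power (t *\<^sub>R A) k)) sums (A ** mat_exp (t *\<^sub>R A))"
    by (rule bounded_linear.sums[OF R mat_exp_sums])
  have "A ** mat_power A k = mat_power A k ** A" for k
    using mat_power_Suc_right[of A k] by simp
  then show "(\<lambda>k. A ** ((1 / fact k) *\<^sub>R mat_power (t *\<^sub>R A) k)) sums (mat_exp (t *\<^sub>R A) ** A)"
    using bounded_linear.sums[OF L mat_exp_sums, of "t *\<^sub>R A" A]
    by (simp add: mat_power_scaleR matrix_scalar_ac flip: scalar_matrix_assoc)
qed

lemma mat_exp_zero [simp]: "mat_exp 0 = (mat 1 :: real^'n^'n)"
proof (rule sums_unique2[OF mat_exp_sums])
  have "mat_power 0 k = (if k = 0 then mat 1 else (0 :: real^'n^'n))" for k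
    using mat_power_scaleR[of 0 "0 :: real^'n^'n" k] by (cases k) auto
  then have "(\<lambda>k. (1 / fact k) *\<^sub>R mat_power (0 :: real^'n^'n) k) = (\<lambda>k. if k = 0 then mat 1 else 0)"
    by auto
  then show "(\<lambda>k. (1 / fact k) *\<^sub>R mat_power (0 :: real^'n^'n) k) sums mat 1"
    using sums_single[of 0 "\<lambda>_. mat 1 :: real^'n^'n"] by simp
qed

lemma has_vector_derivative_mat_exp:
  fixes A :: "real^'n^'n"
  shows "((\<lambda>t. mat_exp (t *\<^sub>R A)) has_vector_derivative (mat_exp (t *\<^sub>R A) ** A)) (at t within S)"
proof -
  \<comment> \<open>Each entry is a real power series in \<open>t\<close>, which may be differentiated termwise.\<close>
  have entry: "((\<lambda>t. mat_exp (t *\<^sub>R A) $ i $ j) has_real_derivative ((mat_exp (t *\<^sub>R A) ** A) $ i $ j)) (at t)"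
    for i j
  proof -
    let ?c = "\<lambda>k. mat_power A k $ i $ j / fact k"
    have "((\<lambda>t. \<Sum>k. ?c k * t ^ k) has_real_derivative (\<Sum>k. diffs ?c k * t ^ k)) (at t)"
      by (rule termdiffs_strong_converges_everywhere) (use mat_exp_entry_sums in \<open>blast intro: sums_summable\<close>)
    moreover have "(\<lambda>t. \<Sum>k. ?c k * t ^ k) = (\<lambda>t. mat_exp (t *\<^sub>R A) $ i $ j)"
      by (intro ext sums_unique[symmetric] mat_exp_entry_sums)
    moreover have "(\<Sum>k. diffs ?c k * t ^ k) = (mat_exp (t *\<^sub>R A) ** A) $ i $ j"
    proof (rule sums_unique[symmetric])
      have "(\<lambda>k. \<Sum>l\<in>UNIV. (mat_power A k $ i $ l / fact k * t ^ k) * A $ l $ j) sums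
              (\<Sum>l\<in>UNIV. mat_exp (t *\<^sub>R A) $ i $ l * A $ l $ j)"
        by (intro sums_sum sums_mult2 mat_exp_entry_sums)
      moreover have "(\<Sum>l\<in>UNIV. (mat_power A k $ i $ l / fact k * t ^ k) * A $ l $ j) = diffs ?c k * t ^ k" for k
      proof -
        have "diffs ?c k = mat_power A (Suc k) $ i $ j / fact k"
          by (simp add: diffs_def del: mat_power.simps)
        then show ?thesis
          unfolding mat_power_Suc_right
          by (simp add: matrix_matrix_mult_def sum_divide_distrib sum_distrib_left sum_distrib_right mult_ac)
      qed
      ultimately show "(\<lambda>k. diffs ?c k * t ^ k) sums ((mat_exp (t *\<^sub>R A) ** A) $ i $ j)"
        by (simp add: matrix_matrix_mult_def)
    qed
    ultimately show ?thesis by simp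
  qed
  have "((\<lambda>t. mat_exp (t *\<^sub>R A)) has_vector_derivative (mat_exp (t *\<^sub>R A) ** A)) (at t)"
    unfolding has_vector_derivative_def
    by (subst has_derivative_componentwise_within)
      (use entry in \<open>auto simp: Basis_vec_def inner_axis has_field_derivative_def mult_commute_abs\<close>)
  then show ?thesis by (rule has_vector_derivative_at_within)
qed

lemma has_vector_derivative_mat_exp_apply:
  fixes A :: "real^'n^'n"
  shows "((\<lambda>t. mat_exp (t *\<^sub>R A) *v x) has_vector_derivative (A *v (mat_exp (t *\<^sub>R A) *v x))) (at t within S)"
  using bounded_linear.has_vector_derivative[OF
      bounded_bilinear.bounded_linear_left[OF bounded_bilinear_matrix_vector_mult]
      has_vector_derivative_mat_exp, of A x t S]
  by (simp add: matrix_vector_mul_assoc mat_exp_commute)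

section \<open>Quadratic forms along the linear flow\<close>

lemma lyapunov_form:
  fixes A K :: "real^'n^'n"
  assumes sym: "transpose K = K" and a: "transpose A ** K + K ** A + (2 * \<gamma>) *\<^sub>R K \<preceq>\<^sub>L 0"
  shows "2 * (v \<bullet> (K *v (A *v v))) + 2 * \<gamma> * (v \<bullet> (K *v v)) \<le> 0"
proof -
  let ?L = "transpose A ** K + K ** A + (2 * \<gamma>) *\<^sub>R K"
  have "0 \<le> v \<bullet> ((0 - ?L) *v v)"
    using a unfolding loewner_le_def pos_semidef_def by blast
  also have "\<dots> = - (v \<bullet> (?L *v v))"
    unfolding matrix_vector_mult_diff_rdistrib by simp
  also have "v \<bullet> (?L *v v) = v \<bullet> (transpose A *v (K *v v)) + v \<bullet> (K *v (A *v v)) + 2 * \<gamma> * (v \<bullet> (K *v v))"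
    by (simp add: matrix_vector_mult_add_rdistrib inner_right_distrib matrix_vector_mul_assoc
        flip: scaleR_matrix_vector_assoc)
  also have "v \<bullet> (transpose A *v (K *v v)) = (A *v v) \<bullet> (K *v v)"
    by (metis dot_lmul_matrix vector_transpose_matrix)
  also have "\<dots> = v \<bullet> (K *v (A *v v))"
    using symmetric_dot[OF sym] by (metis inner_commute)
  finally show ?thesis by simp
qed

text \<open>
  The assumption on \<open>A\<close> is the Lyapunov inequality \<open>A\<^sup>T K + K A + 2 \<gamma> K \<preceq> 0\<close> as an inequality between
  quadratic forms; \<open>K\<close> may be indefinite.
\<close>
lemma quadratic_form_decay:
  fixes A K :: "real^'n^'n" and x :: "real^'n"
  assumes sym: "transpose K = K"
    and lyap: "\<And>v. 2 * (v \<bullet> (K *v (A *v v))) + 2 * \<gamma> * (v \<bullet> (K *v v)) \<le> 0"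
    and "0 \<le> t"
  defines "\<phi> \<equiv> \<lambda>s. mat_exp (s *\<^sub>R A) *v x"
  shows "exp (2 * \<gamma> * t) * (\<phi> t \<bullet> (K *v \<phi> t)) \<le> x \<bullet> (K *v x)"
proof -
  let ?h = "\<lambda>s. exp (2 * \<gamma> * s) * (\<phi> s \<bullet> (K *v \<phi> s))"
  have der: "(\<phi> has_vector_derivative A *v \<phi> s) (at s)" for s
    unfolding \<phi>_def by (rule has_vector_derivative_mat_exp_apply)
  have derK: "((\<lambda>s. K *v \<phi> s) has_vector_derivative K *v (A *v \<phi> s)) (at s)" for s
    by (rule bounded_linear.has_vector_derivative[OF matrix_vector_mul_bounded_linear der])
  have Q: "((\<lambda>s. \<phi> s \<bullet> (K *v \<phi> s)) has_real_derivative 2 * (\<phi> s \<bullet> (K *v (A *v \<phi> s)))) (at s)" for s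
  proof -
    have "((\<lambda>s. \<phi> s \<bullet> (K *v \<phi> s)) has_vector_derivative
        \<phi> s \<bullet> (K *v (A *v \<phi> s)) + (A *v \<phi> s) \<bullet> (K *v \<phi> s)) (at s)"
      by (rule bounded_bilinear.has_vector_derivative[OF bounded_bilinear_inner der derK])
    moreover have "(A *v \<phi> s) \<bullet> (K *v \<phi> s) = \<phi> s \<bullet> (K *v (A *v \<phi> s))"
      using symmetric_dot[OF sym] by (metis inner_commute)
    ultimately show ?thesis by (simp add: has_real_derivative_iff_has_vector_derivative)
  qed
  have "?h t \<le> ?h 0"
  proof (rule DERIV_nonpos_imp_nonincreasing[OF \<open>0 \<le> t\<close>], intro exI conjI)
    fix s
    let ?d = "exp (2 * \<gamma> * s) * (2 * (\<phi> s \<bullet> (K *v (A *v \<phi> s))) + 2 * \<gamma> * (\<phi> s \<bullet> (K *v \<phi> s)))"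
    show "(?h has_real_derivative ?d) (at s)"
      by (auto intro!: derivative_eq_intros Q simp: algebra_simps)
    show "?d \<le> 0"
      using lyap[of "\<phi> s"] by (intro mult_nonneg_nonpos) auto
  qed
  then show ?thesis by (simp add: \<phi>_def)
qed

lemma mat_exp_apply_nonzero:
  fixes A :: "real^'n^'n"
  assumes "x \<noteq> 0" "0 \<le> t"
  shows "mat_exp (t *\<^sub>R A) *v x \<noteq> 0"
proof
  assume zero: "mat_exp (t *\<^sub>R A) *v x = 0"
  obtain L where L: "\<And>v. norm (A *v v) \<le> norm v * L"
    using bounded_linear.bounded[OF matrix_vector_mul_bounded_linear[of A]] by auto
  have neg: "(- mat 1) *v v = - v" for v :: "real^'n"
    using matrix_vector_mult_diff_rdistrib[of 0 "mat 1" v] by simp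
  \<comment> \<open>The previous lemma for \<open>K = - I\<close> and \<open>\<gamma> = L\<close>: the squared norm shrinks at most at the rate \<open>2 L\<close>.\<close>
  have "2 * (v \<bullet> ((- mat 1) *v (A *v v))) + 2 * L * (v \<bullet> ((- mat 1) *v v)) \<le> 0" for v :: "real^'n"
  proof -
    have "- (v \<bullet> (A *v v)) \<le> norm v * norm (A *v v)"
      using Cauchy_Schwarz_ineq2[of v "A *v v"] by linarith
    also have "\<dots> \<le> norm v * (norm v * L)"
      by (intro mult_left_mono L) auto
    also have "\<dots> = L * (v \<bullet> v)"
      by (simp add: power2_norm_eq_inner[symmetric] power2_eq_square)
    finally show ?thesis by (simp add: neg)
  qed
  moreover have "transpose (- mat 1) = (- mat 1 :: real^'n^'n)"
    by (simp add: vec_eq_iff transpose_def mat_def)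
  ultimately have "exp (2 * L * t) * ((mat_exp (t *\<^sub>R A) *v x) \<bullet> ((- mat 1) *v (mat_exp (t *\<^sub>R A) *v x)))
      \<le> x \<bullet> ((- mat 1) *v x)"
    using \<open>0 \<le> t\<close> by (intro quadratic_form_decay)
  with zero have "x \<bullet> x \<le> 0" by (simp add: neg)
  with \<open>x \<noteq> 0\<close> show False
    by (metis inner_gt_zero_iff not_le)
qed

section \<open>The quadratic cone\<close>

lemma pos_on_hyperplane:
  fixes K :: "real^'n^'n" and c :: "real^'n"
  assumes d: "0 \<prec>\<^sub>L K + \<tau> *\<^sub>R outer c c" and x: "c \<bullet> x = 0" "x \<bullet> (K *v x) \<le> 0"
  shows "x = 0"
proof (rule ccontr)
  assume "x \<noteq> 0"
  then have "0 < x \<bullet> ((K + \<tau> *\<^sub>R outer c c) *v x)"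
    using d unfolding loewner_less_def pos_def_def by simp
  moreover have "outer c c *v x = (c \<bullet> x) *\<^sub>R c"
    by (simp add: vec_eq_iff outer_def matrix_vector_mult_def inner_vec_def sum_distrib_left mult_ac)
  ultimately show False
    using x by (simp add: matrix_vector_mult_add_rdistrib flip: scaleR_matrix_vector_assoc)
qed

lemma quad_cone_add:
  fixes K :: "real^'n^'n" and c :: "real^'n"
  assumes sym: "transpose K = K"
    and hyperplane: "\<And>x. c \<bullet> x = 0 \<Longrightarrow> x \<bullet> (K *v x) \<le> 0 \<Longrightarrow> x = 0"
    and x: "x \<in> quad_cone K c" and y: "y \<in> quad_cone K c"
  shows "x + y \<in> quad_cone K c"
proof (cases "c \<bullet> x = 0 \<or> c \<bullet> y = 0")
  case True
  then show ?thesis using x y hyperplane unfolding quad_cone_def by force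
next
  case False
  with x y have pos: "c \<bullet> x > 0" "c \<bullet> y > 0" by (auto simp: quad_cone_def)
  have Qx: "x \<bullet> (K *v x) \<le> 0" and Qy: "y \<bullet> (K *v y) \<le> 0" using x y by (auto simp: quad_cone_def)
  have yx: "y \<bullet> (K *v x) = x \<bullet> (K *v y)"
    using symmetric_dot[OF sym] by (metis inner_commute)
  \<comment> \<open>This combination lies on the hyperplane, where the form is nonnegative: expanding yields the
    reverse Cauchy-Schwarz inequality \<open>x \<bullet> (K *v y) \<le> 0\<close>.\<close>
  define w where "w = (c \<bullet> y) *\<^sub>R x - (c \<bullet> x) *\<^sub>R y"
  have "c \<bullet> w = 0" by (simp add: w_def inner_simps)
  then have "0 \<le> w \<bullet> (K *v w)" using hyperplane[of w] by force
  also have "\<dots> = (c \<bullet> y)\<^sup>2 * (x \<bullet> (K *v x)) + (c \<bullet> x)\<^sup>2 * (y \<bullet> (K *v y))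
      - 2 * ((c \<bullet> x) * (c \<bullet> y)) * (x \<bullet> (K *v y))"
    by (simp add: w_def yx inner_simps matrix_vector_mult_diff_distrib matrix_vector_mult_scaleR
        power2_eq_square algebra_simps)
  finally have "2 * ((c \<bullet> x) * (c \<bullet> y)) * (x \<bullet> (K *v y)) \<le> 0"
    using Qx Qy by (smt (verit) mult_nonneg_nonpos zero_le_power2)
  then have "x \<bullet> (K *v y) \<le> 0"
    using pos by (smt (verit) mult_pos_pos)
  then show ?thesis
    using Qx Qy pos by (simp add: quad_cone_def inner_simps matrix_vector_right_distrib yx)
qed

lemma quad_cone_scaleR: "x \<in> quad_cone K c \<Longrightarrow> 0 \<le> r \<Longrightarrow> r *\<^sub>R x \<in> quad_cone K c"
  by (auto simp: quad_cone_def matrix_vector_mult_scaleR mult_nonneg_nonpos)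

lemma proper_convex_cone_quad_cone:
  fixes K :: "real^'n^'n" and c :: "real^'n"
  assumes sym: "transpose K = K"
    and hyperplane: "\<And>x. c \<bullet> x = 0 \<Longrightarrow> x \<bullet> (K *v x) \<le> 0 \<Longrightarrow> x = 0"
    and v: "v \<bullet> (K *v v) < 0"
  shows "proper_convex_cone (quad_cone K c)"
proof -
  let ?S = "quad_cone K c"
  have zero: "0 \<in> ?S" by (simp add: quad_cone_def)
  have contQ: "continuous_on UNIV (\<lambda>x. x \<bullet> (K *v x))"
    by (intro continuous_intros linear_continuous_on matrix_vector_mul_bounded_linear)
  have contc: "continuous_on UNIV (\<lambda>x. c \<bullet> x)" by (intro continuous_intros)
  have "convex_cone ?S"
    unfolding convex_cone_iff
    using zero quad_cone_add[OF sym hyperplane] quad_cone_scaleR by blast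
  moreover have "closed ?S"
    unfolding quad_cone_def
    by (intro closed_Collect_conj closed_Collect_le contQ contc continuous_intros)
  moreover have "interior ?S \<noteq> {}"
  proof -
    have "c \<bullet> v \<noteq> 0" using hyperplane[of v] v by force
    define w where "w = (if c \<bullet> v > 0 then v else - v)"
    have "c \<bullet> w > 0" using \<open>c \<bullet> v \<noteq> 0\<close> by (simp add: w_def)
    moreover have "w \<bullet> (K *v w) < 0" using v by (simp add: w_def vec.neg)
    moreover have "open {x. x \<bullet> (K *v x) < 0 \<and> 0 < c \<bullet> x}"
      by (intro open_Collect_conj open_Collect_less contQ contc continuous_intros)
    then have "{x. x \<bullet> (K *v x) < 0 \<and> 0 < c \<bullet> x} \<subseteq> interior ?S"
      by (rule interior_maximal[rotated]) (auto simp: quad_cone_def)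
    ultimately show ?thesis by auto
  qed
  moreover have "?S \<inter> uminus ` ?S = {0}"
  proof
    show "?S \<inter> uminus ` ?S \<subseteq> {0}"
      using hyperplane by (force simp: quad_cone_def)
    show "{0} \<subseteq> ?S \<inter> uminus ` ?S"
      using zero by (force intro: image_eqI[of _ _ 0])
  qed
  ultimately show ?thesis by (simp add: proper_convex_cone_def)
qed

text \<open>
  A functional without zeros on the nonzero part of the cone has constant sign there: one point \<open>y\<close> of
  nonnegative value decides it.
\<close>
lemma quad_cone_functional_pos:
  fixes K :: "real^'n^'n" and c q :: "real^'n"
  assumes sym: "transpose K = K"
    and hc: "\<And>x. c \<bullet> x = 0 \<Longrightarrow> x \<bullet> (K *v x) \<le> 0 \<Longrightarrow> x = 0"
    and hq: "\<And>x. q \<bullet> x = 0 \<Longrightarrow> x \<bullet> (K *v x) \<le> 0 \<Longrightarrow> x = 0"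
    and y: "y \<in> quad_cone K c" "y \<noteq> 0" "0 \<le> q \<bullet> y"
    and x: "x \<in> quad_cone K c" "x \<noteq> 0"
  shows "0 < q \<bullet> x"
proof (rule ccontr)
  assume "\<not> 0 < q \<bullet> x"
  moreover have "q \<bullet> x \<noteq> 0" using hq[of x] x by (auto simp: quad_cone_def)
  ultimately have qx: "q \<bullet> x < 0" by simp
  have qy: "q \<bullet> y > 0" using hq[of y] y by (force simp: quad_cone_def)
  have cx: "c \<bullet> x > 0" using hc[of x] x by (force simp: quad_cone_def)
  have cy: "c \<bullet> y > 0" using hc[of y] y by (force simp: quad_cone_def)
  \<comment> \<open>A positive combination of \<open>x\<close> and \<open>y\<close> with \<open>q \<bullet> w = 0\<close>: it lies in the cone, so it is the
    origin, although \<open>c\<close> is positive on it.\<close>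
  define w where "w = (q \<bullet> y) *\<^sub>R x + (- (q \<bullet> x)) *\<^sub>R y"
  have "w \<in> quad_cone K c"
    unfolding w_def using qx qy by (intro quad_cone_add[OF sym hc] quad_cone_scaleR x y) auto
  moreover have "q \<bullet> w = 0" by (simp add: w_def inner_simps)
  ultimately have "w = 0" using hq[of w] by (simp add: quad_cone_def)
  moreover have "c \<bullet> w > 0"
    unfolding w_def inner_simps using qx qy cx cy by (smt (verit) mult_pos_pos)
  ultimately show False by simp
qed

lemma quad_cone_exp_invariant:
  fixes A K :: "real^'n^'n" and c :: "real^'n"
  assumes sym: "transpose K = K"
    and hyperplane: "\<And>x. c \<bullet> x = 0 \<Longrightarrow> x \<bullet> (K *v x) \<le> 0 \<Longrightarrow> x = 0"
    and lyap: "\<And>v. 2 * (v \<bullet> (K *v (A *v v))) + 2 * \<gamma> * (v \<bullet> (K *v v)) \<le> 0"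
  shows "exp_invariant A (quad_cone K c)"
  unfolding exp_invariant_def
proof (intro allI impI subsetI, elim imageE)
  fix t :: real and x z
  assume t: "0 \<le> t" and x: "x \<in> quad_cone K c" and z: "z = mat_exp (t *\<^sub>R A) *v x"
  let ?\<phi> = "\<lambda>s. mat_exp (s *\<^sub>R A) *v x"
  have neg: "?\<phi> s \<bullet> (K *v ?\<phi> s) \<le> 0" if "0 \<le> s" for s
    using quadratic_form_decay[OF sym lyap that, of x] x
    by (simp add: quad_cone_def) (smt (verit) exp_gt_zero mult_pos_pos)
  have "0 \<le> c \<bullet> ?\<phi> t"
  proof (rule ccontr)
    assume neg_t: "\<not> 0 \<le> c \<bullet> ?\<phi> t"
    have "continuous_on {0..t} ?\<phi>"
      by (rule continuous_on_vector_derivative) (rule has_vector_derivative_mat_exp_apply)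
    then have "continuous_on {0..t} (\<lambda>s. c \<bullet> ?\<phi> s)" by (intro continuous_intros)
    \<comment> \<open>Where the trajectory meets the hyperplane it would have to vanish.\<close>
    then obtain s where s: "0 \<le> s" "s \<le> t" "c \<bullet> ?\<phi> s = 0"
      using IVT2'[of "\<lambda>s. c \<bullet> ?\<phi> s" t 0 0] neg_t t x by (auto simp: quad_cone_def)
    then have "?\<phi> s = 0" using hyperplane neg by blast
    then have "x = 0" using mat_exp_apply_nonzero s(1) by blast
    then show False using neg_t by simp
  qed
  with neg[OF t] show "z \<in> quad_cone K c" by (simp add: quad_cone_def z)
qed

section \<open>Eigenvalues of symmetric matrices\<close>

lemma map_poly_of_real_mult:
  "map_poly complex_of_real (p * q) = map_poly complex_of_real p * map_poly complex_of_real q"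
  by (rule poly_eqI) (simp add: coeff_map_poly coeff_mult)

lemma poly_map_poly_of_real: "poly (map_poly complex_of_real p) (of_real x) = of_real (poly p x)"
  by (induction p) (simp_all add: map_poly_pCons)

lemma real_rooted_size_proots:
  fixes p :: "real poly"
  assumes "\<And>z. poly (map_poly complex_of_real p) z = 0 \<Longrightarrow> z \<in> \<real>"
  shows "size (proots p) = degree p"
  using assms
proof (induction p rule: poly_root_order_induct)
  case 0
  then show ?case by simp
next
  case (no_roots p)
  have "degree p = 0"
  proof (rule ccontr)
    assume "degree p \<noteq> 0"
    then have "\<not> constant (poly (map_poly complex_of_real p))"
      by (simp add: constant_degree degree_map_poly)
    then obtain z where z: "poly (map_poly complex_of_real p) z = 0"
      using fundamental_theorem_of_algebra by blast
    then obtain x where "z = complex_of_real x"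
      using no_roots.prems by (metis Reals_cases)
    with z have "poly p x = 0" by (simp add: poly_map_poly_of_real)
    with no_roots.hyps show False by blast
  qed
  then show ?case using size_proots_le[of p] by simp
next
  case (root p x n)
  have "p \<noteq> 0" using root.hyps by auto
  have "poly (map_poly complex_of_real p) z = 0 \<Longrightarrow> z \<in> \<real>" for z
    using root.prems[of z] by (simp add: map_poly_of_real_mult)
  then have "size (proots p) = degree p" by (rule root.IH)
  with \<open>p \<noteq> 0\<close> show ?case
    by (simp add: proots_mult proots_power degree_mult_eq degree_power_eq)
qed

text \<open>
  In the Leibniz expansion only the identity permutation contributes to the coefficient of degree
  \<open>CARD('n)\<close>.
\<close>
lemma card_le_degree_charpoly: "CARD('n) \<le> degree (charpoly M)" for M :: "real^'n^'n"
proof -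
  let ?N = "mat [:0, 1:] - (\<chi> i j. [:M $ i $ j:]) :: real poly^'n^'n"
  let ?f = "\<lambda>p. of_int (sign p) * (\<Prod>i\<in>UNIV. ?N $ i $ p i)"
  have deg: "degree (?N $ i $ j) \<le> (if i = j then 1 else 0)" for i j
    by (auto simp: mat_def)
  have "coeff (?f p) CARD('n) = 0" if p: "p permutes UNIV" "p \<noteq> id" for p
  proof (rule coeff_eq_0)
    obtain k where k: "p k \<noteq> k" using p by (auto simp: fun_eq_iff)
    have "degree (?f p) \<le> degree (of_int (sign p) :: real poly) + degree (\<Prod>i\<in>UNIV. ?N $ i $ p i)"
      by (rule degree_mult_le)
    also have "\<dots> \<le> (\<Sum>i\<in>UNIV. degree (?N $ i $ p i))"
      using degree_prod_sum_le[of UNIV "\<lambda>i. ?N $ i $ p i"] by (simp add: comp_def)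
    also have "\<dots> < (\<Sum>i\<in>(UNIV :: 'n set). 1)"
    proof (rule sum_strict_mono_ex1)
      have "degree (?N $ i $ p i) \<le> 1" for i
        using deg[of i "p i"] by (simp split: if_splits)
      then show "\<forall>i\<in>UNIV. degree (?N $ i $ p i) \<le> 1" by blast
      show "\<exists>i\<in>UNIV. degree (?N $ i $ p i) < 1"
        using deg[of k "p k"] k by (intro bexI[of _ k]) auto
    qed simp
    finally show "degree (?f p) < CARD('n)" by simp
  qed
  then have "coeff (charpoly M) CARD('n) = coeff (?f id) CARD('n)"
    unfolding charpoly_def det_def coeff_sum
    by (subst sum.remove[of _ id]) (auto simp: permutes_id intro!: sum.neutral)
  also have "?f id = (\<Prod>i\<in>UNIV. [:- (M $ i $ i), 1:])"
    by (simp add: mat_def)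
  also have "coeff \<dots> CARD('n) = 1"
  proof -
    have "degree (\<Prod>i\<in>(UNIV :: 'n set). [:- (M $ i $ i), 1:]) = CARD('n)"
      by (subst degree_prod_sum_eq) auto
    moreover have "lead_coeff (\<Prod>i\<in>(UNIV :: 'n set). [:- (M $ i $ i), 1:]) = 1"
      by (subst lead_coeff_prod) simp
    ultimately show ?thesis by simp
  qed
  finally show ?thesis by (intro le_degree) simp
qed

lemma poly_map_charpoly:
  "poly (map_poly complex_of_real (charpoly M)) z = det (mat z - map_matrix complex_of_real M)"
  for M :: "real^'n^'n"
proof -
  have hom: "map_poly complex_of_real (\<Sum>x\<in>S. f x) = (\<Sum>x\<in>S. map_poly complex_of_real (f x))"
    for f :: "'x \<Rightarrow> real poly" and S
    by (rule poly_eqI) (simp add: coeff_map_poly coeff_sum)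
  have hom': "map_poly complex_of_real (\<Prod>x\<in>S. f x) = (\<Prod>x\<in>S. map_poly complex_of_real (f x))"
    for f :: "'x \<Rightarrow> real poly" and S
    by (induction S rule: infinite_finite_induct) (simp_all add: map_poly_of_real_mult map_poly_pCons)
  have sgn: "map_poly complex_of_real (of_int (sign p)) = of_int (sign p)" for p :: "'n \<Rightarrow> 'n"
    by (simp add: sign_def map_poly_pCons one_pCons)
  have entry: "poly (map_poly complex_of_real ((mat [:0, 1:] - (\<chi> i j. [:M $ i $ j:])) $ i $ j)) z
      = (mat z - map_matrix complex_of_real M) $ i $ j" for i j :: 'n
    by (simp add: mat_def map_poly_pCons)
  show ?thesis
    unfolding charpoly_def det_def
    by (simp only: hom hom' map_poly_of_real_mult sgn poly_sum poly_mult poly_prod poly_of_int entry)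
qed

text \<open>
  The imaginary part \<open>Im z\<close> vanishes because a complex eigenvector \<open>x + i y\<close> of a real symmetric \<open>M\<close> gives
  \<open>0 = x \<bullet> M y - M x \<bullet> y = Im z (x \<bullet> x + y \<bullet> y)\<close>. Then \<open>x\<close> or \<open>y\<close> is a real eigenvector.
\<close>
lemma symmetric_complex_eigenvalue_real:
  fixes M :: "real^'n^'n"
  assumes sym: "transpose M = M" and z: "poly (map_poly complex_of_real (charpoly M)) z = 0"
  shows "z \<in> \<real>" and "\<exists>v. v \<noteq> 0 \<and> M *v v = Re z *\<^sub>R v"
proof -
  let ?N = "mat z - map_matrix complex_of_real M"
  have "det ?N = 0" using z by (simp add: poly_map_charpoly)
  then have "\<not> (\<exists>B. B ** ?N = mat 1)"
    by (metis invertible_det_nz invertible_left_inverse)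
  then obtain w where w: "w \<noteq> 0" "?N *v w = 0"
    unfolding matrix_left_invertible_ker by blast
  define x y where "x = (\<chi> i. Re (w $ i))" and "y = (\<chi> i. Im (w $ i))"
  have eq: "(\<Sum>j\<in>UNIV. M $ i $ j * w $ j) = z * w $ i" for i
  proof -
    have "(\<Sum>j\<in>UNIV. mat z $ i $ j * w $ j) = z * w $ i"
      by (simp add: mat_def if_distrib if_distribR cong: if_cong)
    moreover have "(?N *v w) $ i = 0" using w by simp
    then have "(\<Sum>j\<in>UNIV. mat z $ i $ j * w $ j) - (\<Sum>j\<in>UNIV. M $ i $ j * w $ j) = 0"
      by (simp add: matrix_vector_mult_def left_diff_distrib sum_subtractf)
    ultimately show ?thesis by simp
  qed
  have Mx: "M *v x = Re z *\<^sub>R x - Im z *\<^sub>R y"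
    using arg_cong[OF eq, of Re] by (simp add: vec_eq_iff matrix_vector_mult_def x_def y_def)
  have My: "M *v y = Re z *\<^sub>R y + Im z *\<^sub>R x"
    using arg_cong[OF eq, of Im] by (simp add: vec_eq_iff matrix_vector_mult_def x_def y_def)
  have xy: "x \<noteq> 0 \<or> y \<noteq> 0"
    using w(1) by (auto simp: vec_eq_iff x_def y_def complex_eq_iff)
  have "x \<bullet> (M *v y) = (M *v x) \<bullet> y"
    using sym by (metis dot_lmul_matrix transpose_matrix_vector)
  then have "Im z * (x \<bullet> x + y \<bullet> y) = 0"
    unfolding Mx My by (simp add: inner_simps algebra_simps)
  moreover have "x \<bullet> x + y \<bullet> y \<noteq> 0"
    using xy by (simp add: add_nonneg_eq_0_iff)
  ultimately have im: "Im z = 0" by simp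
  then show "z \<in> \<real>" by (simp add: complex_is_Real_iff)
  show "\<exists>v. v \<noteq> 0 \<and> M *v v = Re z *\<^sub>R v"
    using xy Mx My im by auto
qed

text \<open>
  Since the characteristic polynomial of a symmetric matrix splits over the reals, the sorted list of its
  real roots has at least \<open>CARD('n)\<close> entries, so that the index \<open>i - 1\<close> is within its bounds.
\<close>
lemma eigval_is_eigenvalue:
  fixes M :: "real^'n^'n"
  assumes sym: "transpose M = M" and i: "1 \<le> i" "i \<le> CARD('n)"
  obtains v where "v \<noteq> 0" "M *v v = eigval M i *\<^sub>R v"
proof -
  let ?ev = "rev (sorted_list_of_multiset (proots (charpoly M)))"
  have "charpoly M \<noteq> 0"
    using card_le_degree_charpoly[of M] by (metis degree_0 card_0_eq finite UNIV_not_empty le_zero_eq)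
  have "length ?ev = degree (charpoly M)"
    using real_rooted_size_proots symmetric_complex_eigenvalue_real(1)[OF sym]
    by (metis length_rev mset_sorted_list_of_multiset size_mset)
  then have "i - 1 < length ?ev"
    using card_le_degree_charpoly[of M] i by simp
  then have "eigval M i \<in> set ?ev"
    unfolding eigval_def by (rule nth_mem)
  then have "poly (charpoly M) (eigval M i) = 0"
    using \<open>charpoly M \<noteq> 0\<close> by simp
  then have "poly (map_poly complex_of_real (charpoly M)) (complex_of_real (eigval M i)) = 0"
    by (simp add: poly_map_poly_of_real)
  from symmetric_complex_eigenvalue_real(2)[OF sym this] that show ?thesis by auto
qed

section \<open>External positivity\<close>

text \<open>
  The value \<open>q \<bullet> e\<^bsup>A(r + T - s)\<^esup> Y(s)\<close> is nondecreasing in \<open>s\<close>, since along \<open>Y' = A Y + f\<close> its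
  derivative is \<open>q \<bullet> e\<^bsup>A(r + T - s)\<^esup> f(s)\<close>.
\<close>
lemma functional_nonneg_along_ode:
  fixes A :: "real^'n^'n" and q :: "real^'n"
  assumes "0 \<le> T" and cont: "continuous_on {0..T} Y"
    and der: "\<And>s. 0 < s \<Longrightarrow> s < T \<Longrightarrow> (Y has_vector_derivative A *v Y s + f s) (at s)"
    and f: "\<And>s r. 0 \<le> s \<Longrightarrow> 0 \<le> r \<Longrightarrow> 0 \<le> q \<bullet> (mat_exp (r *\<^sub>R A) *v f s)"
    and init: "\<And>r. 0 \<le> r \<Longrightarrow> 0 \<le> q \<bullet> (mat_exp (r *\<^sub>R A) *v Y 0)"
    and "0 \<le> r"
  shows "0 \<le> q \<bullet> (mat_exp (r *\<^sub>R A) *v Y T)"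
proof -
  let ?E = "\<lambda>s. mat_exp ((r + T - s) *\<^sub>R A)"
  let ?g = "\<lambda>s. q \<bullet> (?E s *v Y s)"
  have derE: "(?E has_vector_derivative - (?E s ** A)) (at s within S)" for s S
  proof -
    have "((\<lambda>s. r + T - s) has_vector_derivative - 1) (at s within S)"
      by (auto intro!: derivative_eq_intros)
    from vector_diff_chain_within[OF this has_vector_derivative_mat_exp]
    show ?thesis by (simp add: comp_def)
  qed
  have "?g 0 \<le> ?g T"
  proof (rule DERIV_nonneg_imp_increasing_open[OF \<open>0 \<le> T\<close>])
    fix s assume s: "0 < s" "s < T"
    have "((\<lambda>s. ?E s *v Y s) has_vector_derivative
        ?E s *v (A *v Y s + f s) + (- (?E s ** A)) *v Y s) (at s)"
      by (rule bounded_bilinear.has_vector_derivative[OF bounded_bilinear_matrix_vector_mult derE der[OF s]])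
    also have "?E s *v (A *v Y s + f s) + (- (?E s ** A)) *v Y s = ?E s *v f s"
      using matrix_vector_mult_diff_rdistrib[of 0 "?E s ** A" "Y s"]
      by (simp add: matrix_vector_right_distrib matrix_vector_mul_assoc)
    finally have "(?g has_vector_derivative q \<bullet> (?E s *v f s)) (at s)"
      by (rule bounded_linear.has_vector_derivative[OF bounded_linear_inner_right])
    then have "(?g has_real_derivative q \<bullet> (?E s *v f s)) (at s)"
      by (simp add: has_real_derivative_iff_has_vector_derivative)
    moreover have "0 \<le> q \<bullet> (?E s *v f s)" using f[of s "r + T - s"] s \<open>0 \<le> r\<close> by simp
    ultimately show "\<exists>y. (?g has_real_derivative y) (at s) \<and> 0 \<le> y" by blast
  next
    have "continuous_on {0..T} ?E"
      by (rule continuous_on_vector_derivative[OF derE])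
    then have "continuous_on {0..T} (\<lambda>s. ?E s *v Y s)"
      by (intro bounded_bilinear.continuous_on[OF bounded_bilinear_matrix_vector_mult] cont)
    then show "continuous_on {0..T} ?g" by (intro continuous_intros)
  qed
  moreover have "0 \<le> ?g 0" using init[of "r + T"] \<open>0 \<le> r\<close> \<open>0 \<le> T\<close> by simp
  ultimately show ?thesis by simp
qed

text \<open>
  With \<open>X(t) = \<integral>\<^sub>0\<^sup>t x\<close> and \<open>z = x - A X\<close> the integral equation reads \<open>X' = A X + z\<close>, where
  \<open>z(b) - z(a) = \<integral>\<^sub>a\<^sup>b B u\<close>. The previous lemma applies to \<open>X\<close>, and then to the increment
  \<open>X(t + h) - X(t)\<close>, whose initial value is \<open>X(h)\<close>. So \<open>q \<bullet> X\<close> is nondecreasing, and its derivative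
  \<open>q \<bullet> x\<close> is nonnegative. Only \<open>B u\<close>, not \<open>u\<close>, needs to be integrable, and integrability of \<open>B u\<close>
  follows from that of \<open>A x + B u\<close> because \<open>x\<close> is continuous.
\<close>
lemma trajectory_functional_nonneg:
  fixes A :: "real^'n^'n" and B :: "real^'m^'n" and q :: "real^'n"
  assumes traj: "lti_trajectory A B u x" and x0: "x 0 = 0"
    and u: "\<And>s r. 0 \<le> s \<Longrightarrow> 0 \<le> r \<Longrightarrow> 0 \<le> q \<bullet> (mat_exp (r *\<^sub>R A) *v (B *v u s))"
    and "0 \<le> t"
  shows "0 \<le> q \<bullet> x t"
proof -
  let ?rhs = "\<lambda>s. A *v x s + B *v u s"
  have rhs: "(?rhs has_integral (x t - x 0)) {0..t}" if "0 \<le> t" for t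
    using traj that by (auto simp: lti_trajectory_def)
  have rhs': "(?rhs has_integral (x b - x a)) {a..b}" if "0 \<le> a" "a \<le> b" for a b
  proof -
    have "?rhs integrable_on {a..b}"
      using rhs[of b] that by (intro integrable_on_subinterval[of ?rhs "{0..b}" a b]) (auto simp: has_integral_integrable)
    then have "(?rhs has_integral integral {a..b} ?rhs) {a..b}" by (rule integrable_integral)
    moreover from this have "(?rhs has_integral ((x a - x 0) + integral {a..b} ?rhs)) {0..b}"
      using rhs[of a] that by (intro has_integral_combine[of 0 a b]) auto
    then have "(x a - x 0) + integral {a..b} ?rhs = x b - x 0"
      using rhs[of b] that by (intro has_integral_unique) auto
    then have "integral {a..b} ?rhs = x b - x a" by (simp add: algebra_simps)
    ultimately show ?thesis by simp
  qed
  have contx: "continuous_on {0..b} x" for b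
  proof (cases "0 \<le> b")
    case True
    have "continuous_on {0..b} (\<lambda>s. integral {0..s} ?rhs)"
      using rhs[OF True] by (intro indefinite_integral_continuous_1) auto
    moreover have "integral {0..s} ?rhs = x s" if "s \<in> {0..b}" for s
      using rhs[of s] that x0 by (auto intro: integral_unique)
    ultimately show ?thesis by (rule continuous_on_eq)
  qed simp
  define X where "X = (\<lambda>t. integral {0..t} x)"
  have derX: "(X has_vector_derivative x s) (at s within {0..b})" if "s \<in> {0..b}" for s b
    unfolding X_def by (rule integral_has_vector_derivative[OF contx that])
  have derX': "(X has_vector_derivative x s) (at s)" if "0 < s" for s
    using derX[of s "s + 1"] that at_within_Icc_at[of 0 s "s + 1"] by simp
  have contX: "continuous_on {0..b} X" for b
    by (rule continuous_on_vector_derivative[OF derX])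
  have X0: "X 0 = 0" by (simp add: X_def)
  define z where "z = (\<lambda>s. x s - A *v X s)"
  have zx: "x s = A *v X s + z s" for s by (simp add: z_def)
  have z0: "z 0 = 0" by (simp add: z_def X0 x0)
  have zmono: "0 \<le> q \<bullet> (mat_exp (r *\<^sub>R A) *v (z b - z a))" if ab: "0 \<le> a" "a \<le> b" and r: "0 \<le> r" for a b r
  proof -
    have "(x has_integral (X b - X a)) {a..b}"
      by (rule fundamental_theorem_of_calculus[OF ab(2)])
         (use ab in \<open>auto intro!: has_vector_derivative_within_subset[OF derX[of _ b]]\<close>)
    from has_integral_linear[OF this matrix_vector_mul_bounded_linear[of A]]
    have "((\<lambda>s. A *v x s) has_integral A *v (X b - X a)) {a..b}"
      by (simp add: comp_def)
    from has_integral_diff[OF rhs'[OF ab] this]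
    have "((\<lambda>s. B *v u s) has_integral (z b - z a)) {a..b}"
      by (simp add: z_def matrix_vector_mult_diff_distrib algebra_simps)
    then have "((\<lambda>s. q \<bullet> (mat_exp (r *\<^sub>R A) *v (B *v u s))) has_integral 
        q \<bullet> (mat_exp (r *\<^sub>R A) *v (z b - z a))) {a..b}"
      using has_integral_linear[OF _ bounded_linear_compose[OF bounded_linear_inner_right
            matrix_vector_mul_bounded_linear], of "\<lambda>s. B *v u s" _ "{a..b}" q "mat_exp (r *\<^sub>R A)"]
      by (simp add: comp_def)
    then show ?thesis by (rule has_integral_nonneg) (use u ab r in auto)
  qed
  have XE: "0 \<le> q \<bullet> (mat_exp (r *\<^sub>R A) *v X T)" if "0 \<le> T" "0 \<le> r" for r T
  proof (rule functional_nonneg_along_ode[OF \<open>0 \<le> T\<close> contX _ _ _ \<open>0 \<le> r\<close>, of A z])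
    show "(X has_vector_derivative A *v X s + z s) (at s)" if "0 < s" "s < T" for s
      using derX'[OF that(1)] by (simp flip: zx)
    show "0 \<le> q \<bullet> (mat_exp (r *\<^sub>R A) *v z s)" if "0 \<le> s" "0 \<le> r" for s r
      using zmono[of 0 s r] that z0 by simp
  qed (simp add: X0)
  have Xmono: "q \<bullet> X T \<le> q \<bullet> X (T + h)" if "0 \<le> T" "0 < h" for T h
  proof -
    let ?Y = "\<lambda>s. X (s + h) - X s"
    have "0 \<le> q \<bullet> (mat_exp (0 *\<^sub>R A) *v ?Y T)"
    proof (rule functional_nonneg_along_ode[OF \<open>0 \<le> T\<close>, of ?Y A "\<lambda>s. z (s + h) - z s"])
      have "continuous_on {0..T} (\<lambda>s. X (s + h))"
        by (rule continuous_on_compose2[OF contX[of "T + h"]]) (use \<open>0 < h\<close> in \<open>auto intro!: continuous_intros\<close>)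
      then show "continuous_on {0..T} ?Y" by (intro continuous_intros contX)
      fix s :: real assume s: "0 < s" "s < T"
      have "((\<lambda>s. s + h) has_vector_derivative 1) (at s)"
        by (auto intro!: derivative_eq_intros)
      from vector_diff_chain_at[OF this, of X "x (s + h)"] derX'[of "s + h"] s \<open>0 < h\<close>
      have "((\<lambda>s. X (s + h)) has_vector_derivative x (s + h)) (at s)"
        by (simp add: comp_def)
      from has_vector_derivative_diff[OF this derX'[OF s(1)]]
      show "(?Y has_vector_derivative A *v ?Y s + (z (s + h) - z s)) (at s)"
        by (simp add: z_def matrix_vector_mult_diff_distrib)
    next
      show "0 \<le> q \<bullet> (mat_exp (r *\<^sub>R A) *v (z (s + h) - z s))" if "0 \<le> s" "0 \<le> r" for s r
        using zmono[of s "s + h" r] that \<open>0 < h\<close> by simp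
      show "0 \<le> q \<bullet> (mat_exp (r *\<^sub>R A) *v (X (0 + h) - X 0))" if "0 \<le> r" for r
        using XE[of h r] that \<open>0 < h\<close> X0 by simp
    qed simp
    then show ?thesis by (simp add: inner_diff_right)
  qed
  show ?thesis
  proof (cases "t = 0")
    case True
    then show ?thesis by (simp add: x0)
  next
    case False
    with \<open>0 \<le> t\<close> have "0 < t" by simp
    have "((\<lambda>s. q \<bullet> X s) has_real_derivative q \<bullet> x t) (at t)"
      using bounded_linear.has_vector_derivative[OF bounded_linear_inner_right derX'[OF \<open>0 < t\<close>]]
      by (simp add: has_real_derivative_iff_has_vector_derivative)
    then show ?thesis
      using DERIV_neg_dec_right[of "\<lambda>s. q \<bullet> X s" "q \<bullet> x t" t] Xmono[OF \<open>0 \<le> t\<close>]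
      by (meson dense leD not_le)
  qed
qed

lemma externally_positive_if_impulse_response_nonneg:
  fixes A :: "real^'n^'n" and B :: "real^'m^'n" and C :: "real^'n^'k" and D :: "real^'m^'k"
  assumes imp: "\<And>t. 0 \<le> t \<Longrightarrow> nonneg_mat (C ** mat_exp (t *\<^sub>R A) ** B)" and D: "nonneg_mat D"
  shows "externally_positive A B C D"
  unfolding externally_positive_def nonneg_vec_def
proof (intro allI impI, elim conjE)
  fix u x and t :: real and i
  assume traj: "lti_trajectory A B u x" and x0: "x 0 = 0" and u: "\<forall>t\<ge>0. \<forall>i. 0 \<le> u t $ i" and t: "0 \<le> t"
  have "0 \<le> row i C \<bullet> (mat_exp (r *\<^sub>R A) *v (B *v u s))" if "0 \<le> s" "0 \<le> r" for s r
  proof -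
    have "row i C \<bullet> (mat_exp (r *\<^sub>R A) *v (B *v u s)) = ((C ** mat_exp (r *\<^sub>R A) ** B) *v u s) $ i"
      by (simp add: matrix_vector_mul_component row_def vec_nth_inverse flip: matrix_vector_mul_assoc)
    also have "\<dots> \<ge> 0"
      using imp[OF that(2)] u that(1)
      by (auto simp: matrix_vector_mult_def nonneg_mat_def intro!: sum_nonneg)
    finally show ?thesis .
  qed
  then have "0 \<le> row i C \<bullet> x t" by (rule trajectory_functional_nonneg[OF traj x0 _ t])
  then have "0 \<le> (C *v x t) $ i" by (simp add: matrix_vector_mul_component row_def vec_nth_inverse)
  moreover have "0 \<le> (D *v u t) $ i"
    using D u t by (auto simp: matrix_vector_mult_def nonneg_mat_def intro!: sum_nonneg)
  ultimately show "0 \<le> (C *v x t + D *v u t) $ i" by simp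
qed

section \<open>Positivity of the system\<close>

theorem theorem1:
  fixes A :: "real^'n^'n" and B :: "real^'m^'n" and C :: "real^'n^'k" and D :: "real^'m^'k"
    and K :: "real^'n^'n" and \<gamma> :: real and \<tau> :: "'k \<Rightarrow> real" and i1 :: 'k
  assumes sym: "transpose K = K"
    and a: "transpose A ** K + K ** A + (2 * \<gamma>) *\<^sub>R K \<preceq>\<^sub>L 0"
    and b: "\<And>j. column j B \<bullet> (K *v column j B) \<le> 0"
    and c_pos: "CARD('n) \<ge> 2 \<Longrightarrow> eigval K (CARD('n) - 1) > 0"
    and c_neg: "0 > eigval K CARD('n)"
    and d: "\<And>i. 0 \<prec>\<^sub>L K + \<tau> i *\<^sub>R outer (row i C) (row i C)"
    and e: "nonneg_mat (C ** B)" "nonneg_mat D"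
    and B_nonzero: "\<And>j. column j B \<noteq> 0"
  shows "cone_positive (quad_cone K (row i1 C)) A B C D
       \<and> externally_positive A B C D
       \<and> (\<forall>t\<ge>0. \<forall>i j. 0 < (C ** mat_exp (t *\<^sub>R A) ** B) $ i $ j)"
proof -
  let ?S = "quad_cone K (row i1 C)"
  note hyp = pos_on_hyperplane[OF d]
  note lyap = lyapunov_form[OF sym a]
  obtain v where v: "v \<noteq> 0" "K *v v = eigval K CARD('n) *\<^sub>R v"
    using eigval_is_eigenvalue[OF sym, of "CARD('n)"] by auto
  then have Qv: "v \<bullet> (K *v v) < 0"
    using c_neg by (simp add: mult_neg_pos)
  have proper: "proper_convex_cone ?S"
    by (rule proper_convex_cone_quad_cone[OF sym hyp Qv])
  have inv: "exp_invariant A ?S"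
    by (rule quad_cone_exp_invariant[OF sym hyp lyap])
  have CB: "0 \<le> row i C \<bullet> column j B" for i j
    using e(1) matrix_triple_entry[of C "mat 1" B i j]
    unfolding nonneg_mat_def matrix_mul_rid matrix_vector_mul_lid by metis
  have BS: "column j B \<in> ?S" for j
    using b CB by (simp add: quad_cone_def)
  have pos: "0 < row i C \<bullet> x" if "x \<in> ?S" "x \<noteq> 0" for i x
    by (rule quad_cone_functional_pos[OF sym hyp hyp BS B_nonzero CB that])
  have impulse: "0 < (C ** mat_exp (t *\<^sub>R A) ** B) $ i $ j" if "0 \<le> t" for t i j
    unfolding matrix_triple_entry
  proof (rule pos)
    show "mat_exp (t *\<^sub>R A) *v column j B \<in> ?S"
      using inv BS that unfolding exp_invariant_def by blast
    show "mat_exp (t *\<^sub>R A) *v column j B \<noteq> 0"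
      by (rule mat_exp_apply_nonzero[OF B_nonzero that])
  qed
  have "row i C \<in> dual_cone ?S" for i
    unfolding dual_cone_def using pos[of _ i] by (force simp: less_imp_le)
  then have "cone_positive ?S A B C D"
    using proper inv BS e(2) by (simp add: cone_positive_def AB_invariant_def)
  moreover have "externally_positive A B C D"
    using impulse e(2)
    by (intro externally_positive_if_impulse_response_nonneg) (auto simp: nonneg_mat_def less_imp_le)
  ultimately show ?thesis using impulse by blast
qed

end
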